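(* Let $(M,J)$ be an almost complex manifold, i.e. $J\colon\mathfrak X(M)\to\mathfrak X(M)$ is $\mathfrak F(M)$-linear with $J^2=-Id$. For $\lambda\in\{+1,-1\}$ consider the generalized almost complex structure $$\mathcal J_{\lambda,J}=\begin{pmatrix}J&0\\0&\lambda J^*\end{pmatrix}$$ on $\mathbb TM=TM\oplus T^*M$, and let $\mathcal G_0$ be the natural generalized metric. Then $(\mathcal J_{-1,J},\mathcal G_0)$ is a generalized indefinite almost Hermitian structure and $(\mathcal J_{+1,J},\mathcal G_0)$ is a generalized almost Norden structure. Depending on $\lambda$, the fundamental tensor of $(\mathcal J_{\lambda,J},\mathcal G_0)$ is $$\Phi_{\mathcal J_{\lambda,J}}(X+\xi,Y+\eta)=\mathcal G_0(JX+\xi,\lambda JY+\eta)$$ for all $X,Y\in\mathfrak X(M)$, $\xi,\eta\in\Lambda^1(M)$.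
   Context: $\mathfrak F(M)$ is the ring of smooth functions, $\mathfrak X(M)$ the vector fields, $\Lambda^1(M)$ the 1-forms; sections of $\mathbb TM$ are written $X+\xi$. Matrix notation: $\begin{pmatrix}H&\sigma\\ \tau&K\end{pmatrix}(X+\xi)=(HX+\sigma\xi)+(\tau X+K\xi)$. Dual: $(J^*\xi)(X)=\xi(JX)$. A generalized almost complex structure is an $\mathfrak F(M)$-linear endomorphism $\mathcal J$ of $\Gamma(\mathbb TM)$ with $\mathcal J^2=-Id$. The natural generalized metric is $\mathcal G_0(X+\xi,Y+\eta)=\frac12(\xi(Y)+\eta(X))$; it is pseudo-Riemannian of neutral signature. For a generalized almost complex structure $\mathcal J$ and a non-positive-definite metric $\mathcal G$ on $\mathbb TM$, the pair $(\mathcal J,\mathcal G)$ is generalized indefinite almost Hermitian if $\mathcal G(\mathcal Ju,\mathcal Jv)=\mathcal G(u,v)$ for all sections $u,v$, and generalized almost Norden if $\mathcal G(\mathcal Ju,\mathcal Jv)=-\mathcal G(u,v)$ for all $u,v$. The fundamental tensor of $(\mathcal J,\mathcal G)$ is $\Phi_{\mathcal J}(u,v)=\mathcal G(\mathcal Ju,v)$. *)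

theory Defs
  imports "HOL-Analysis.Analysis" "HOL-Library.Function_Algebras"
begin

text \<open>
  For an open set \<open>S\<close>, a map is of class \<open>C\<^bsup>k+1\<^esup>\<close> iff it is differentiable and all its
  directional derivatives are of class \<open>C\<^bsup>k\<^esup>\<close>.
\<close>

primrec Ck_on :: "nat \<Rightarrow> 'e::euclidean_space set \<Rightarrow> ('e \<Rightarrow> 'b::real_normed_vector) \<Rightarrow> bool" where
  "Ck_on 0 S f \<longleftrightarrow> continuous_on S f"
| "Ck_on (Suc k) S f \<longleftrightarrow>
     (\<forall>x\<in>S. f differentiable (at x)) \<and> (\<forall>v. Ck_on k S (\<lambda>x. frechet_derivative f (at x) v))"

definition smooth_on :: "'e::euclidean_space set \<Rightarrow> ('e \<Rightarrow> 'b::real_normed_vector) \<Rightarrow> bool" where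
  "smooth_on S f \<longleftrightarrow> (\<forall>k. Ck_on k S f)"

text \<open>
  The manifold is the whole of a Hausdorff second countable type \<open>'m\<close>, with a smooth structure
  given by a (not necessarily maximal) atlas modelled on \<open>'e\<close>.
\<close>

type_synonym ('m, 'e) chart = "'m set \<times> ('m \<Rightarrow> 'e)"

definition smooth_atlas ::
    "('m::{t2_space,second_countable_topology}, 'e::euclidean_space) chart set \<Rightarrow> bool" where
  "smooth_atlas A \<longleftrightarrow>
     (\<forall>(U, \<phi>)\<in>A. open U \<and> open (\<phi> ` U) \<and> homeomorphism U (\<phi> ` U) \<phi> (inv_into U \<phi>)) \<and>
     (\<Union>(U, \<phi>)\<in>A. U) = UNIV \<and>
     (\<forall>(U, \<phi>)\<in>A. \<forall>(V, \<psi>)\<in>A. smooth_on (\<phi> ` (U \<inter> V)) (\<psi> \<circ> inv_into U \<phi>))"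

definition smooth_functions ::
    "('m::{t2_space,second_countable_topology}, 'e::euclidean_space) chart set \<Rightarrow> ('m \<Rightarrow> real) set" where
  "smooth_functions A = {f. \<forall>(U, \<phi>)\<in>A. smooth_on (\<phi> ` U) (f \<circ> inv_into U \<phi>)}"

text \<open>
  Multiplication by a function, for any module whose elements are maps into real functions on \<open>'m\<close>.
  It serves both vector fields and 1-forms.
\<close>

definition fscale :: "('m \<Rightarrow> real) \<Rightarrow> ('a \<Rightarrow> 'm \<Rightarrow> real) \<Rightarrow> 'a \<Rightarrow> 'm \<Rightarrow> real" where
  "fscale f u = (\<lambda>a. f * u a)"

text \<open>
  Vector fields are the derivations of the algebra of smooth functions, the tangent vector at \<open>p\<close>
  being \<open>\<lambda>f. X f p\<close>; 1-forms are the function-linear maps from vector fields to smooth functions.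
  Both are normalised to be \<open>0\<close> outside their domain, so that HOL equality is equality of fields.
\<close>

type_synonym 'm field = "('m \<Rightarrow> real) \<Rightarrow> 'm \<Rightarrow> real"
type_synonym 'm form = "'m field \<Rightarrow> 'm \<Rightarrow> real"

definition vector_fields ::
    "('m::{t2_space,second_countable_topology}, 'e::euclidean_space) chart set \<Rightarrow> 'm field set" where
  "vector_fields A = {X.
     (\<forall>f\<in>smooth_functions A. X f \<in> smooth_functions A) \<and>
     (\<forall>f\<in>smooth_functions A. \<forall>g\<in>smooth_functions A. X (f + g) = X f + X g) \<and>
     (\<forall>c. \<forall>f\<in>smooth_functions A. X ((\<lambda>_. c) * f) = (\<lambda>_. c) * X f) \<and>
     (\<forall>f\<in>smooth_functions A. \<forall>g\<in>smooth_functions A. X (f * g) = X f * g + f * X g) \<and>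
     (\<forall>f. f \<notin> smooth_functions A \<longrightarrow> X f = 0)}"

definition one_forms ::
    "('m::{t2_space,second_countable_topology}, 'e::euclidean_space) chart set \<Rightarrow> 'm form set" where
  "one_forms A = {\<xi>.
     (\<forall>X\<in>vector_fields A. \<xi> X \<in> smooth_functions A) \<and>
     (\<forall>X\<in>vector_fields A. \<forall>Y\<in>vector_fields A. \<xi> (X + Y) = \<xi> X + \<xi> Y) \<and>
     (\<forall>f\<in>smooth_functions A. \<forall>X\<in>vector_fields A. \<xi> (fscale f X) = f * \<xi> X) \<and>
     (\<forall>X. X \<notin> vector_fields A \<longrightarrow> \<xi> X = 0)}"

text \<open>The pair \<open>(X, \<xi>)\<close> is the section \<open>X + \<xi>\<close> of \<open>TM \<oplus> T\<^sup>*M\<close>.\<close>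

type_synonym 'm gen_section = "'m field \<times> 'm form"

definition gen_sections ::
    "('m::{t2_space,second_countable_topology}, 'e::euclidean_space) chart set \<Rightarrow> 'm gen_section set" where
  "gen_sections A = vector_fields A \<times> one_forms A"

definition gen_scale :: "('m \<Rightarrow> real) \<Rightarrow> 'm gen_section \<Rightarrow> 'm gen_section" where
  "gen_scale f = (\<lambda>(X, \<xi>). (fscale f X, fscale f \<xi>))"

definition almost_complex_structure ::
    "('m::{t2_space,second_countable_topology}, 'e::euclidean_space) chart set \<Rightarrow>
     ('m field \<Rightarrow> 'm field) \<Rightarrow> bool" where
  "almost_complex_structure A J \<longleftrightarrow>
     (\<forall>X\<in>vector_fields A. J X \<in> vector_fields A) \<and>
     (\<forall>X\<in>vector_fields A. \<forall>Y\<in>vector_fields A. J (X + Y) = J X + J Y) \<and>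
     (\<forall>f\<in>smooth_functions A. \<forall>X\<in>vector_fields A. J (fscale f X) = fscale f (J X)) \<and>
     (\<forall>X\<in>vector_fields A. J (J X) = - X)"

definition gen_almost_complex_structure ::
    "('m::{t2_space,second_countable_topology}, 'e::euclidean_space) chart set \<Rightarrow>
     ('m gen_section \<Rightarrow> 'm gen_section) \<Rightarrow> bool" where
  "gen_almost_complex_structure A \<J> \<longleftrightarrow>
     (\<forall>u\<in>gen_sections A. \<J> u \<in> gen_sections A) \<and>
     (\<forall>u\<in>gen_sections A. \<forall>v\<in>gen_sections A. \<J> (u + v) = \<J> u + \<J> v) \<and>
     (\<forall>f\<in>smooth_functions A. \<forall>u\<in>gen_sections A. \<J> (gen_scale f u) = gen_scale f (\<J> u)) \<and>
     (\<forall>u\<in>gen_sections A. \<J> (\<J> u) = - u)"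

definition dual_map ::
    "('m::{t2_space,second_countable_topology}, 'e::euclidean_space) chart set \<Rightarrow>
     ('m field \<Rightarrow> 'm field) \<Rightarrow> 'm form \<Rightarrow> 'm form" where
  "dual_map A J \<xi> = (\<lambda>X. if X \<in> vector_fields A then \<xi> (J X) else 0)"

definition block_matrix ::
    "('m field \<Rightarrow> 'm field) \<Rightarrow> ('m form \<Rightarrow> 'm field) \<Rightarrow> ('m field \<Rightarrow> 'm form) \<Rightarrow>
     ('m form \<Rightarrow> 'm form) \<Rightarrow> 'm gen_section \<Rightarrow> 'm gen_section" where
  "block_matrix H \<sigma> \<tau> K = (\<lambda>(X, \<xi>). (H X + \<sigma> \<xi>, \<tau> X + K \<xi>))"

definition gen_J ::
    "('m::{t2_space,second_countable_topology}, 'e::euclidean_space) chart set \<Rightarrow> real \<Rightarrow>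
     ('m field \<Rightarrow> 'm field) \<Rightarrow> 'm gen_section \<Rightarrow> 'm gen_section" where
  "gen_J A l J = block_matrix J (\<lambda>\<xi>. 0) (\<lambda>X. 0) (\<lambda>\<xi>. fscale (\<lambda>_. l) (dual_map A J \<xi>))"

type_synonym 'm gen_form2 = "'m gen_section \<Rightarrow> 'm gen_section \<Rightarrow> 'm \<Rightarrow> real"

definition natural_metric :: "'m gen_form2" where
  "natural_metric = (\<lambda>(X, \<xi>) (Y, \<eta>). \<lambda>p. 1/2 * (\<xi> Y p + \<eta> X p))"

text \<open>The value of the section in the fibre \<open>T\<^sub>pM \<oplus> T\<^sub>p\<^sup>*M\<close> is zero.\<close>

definition vanishes_at ::
    "('m::{t2_space,second_countable_topology}, 'e::euclidean_space) chart set \<Rightarrow>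
     'm gen_section \<Rightarrow> 'm \<Rightarrow> bool" where
  "vanishes_at A = (\<lambda>(X, \<xi>) p.
     (\<forall>f\<in>smooth_functions A. X f p = 0) \<and> (\<forall>Y\<in>vector_fields A. \<xi> Y p = 0))"

text \<open>Non-degeneracy and definiteness are conditions on every fibre, not merely on global sections.\<close>

definition gen_metric ::
    "('m::{t2_space,second_countable_topology}, 'e::euclidean_space) chart set \<Rightarrow>
     'm gen_form2 \<Rightarrow> bool" where
  "gen_metric A G \<longleftrightarrow>
     (\<forall>u\<in>gen_sections A. \<forall>v\<in>gen_sections A. G u v \<in> smooth_functions A) \<and>
     (\<forall>u\<in>gen_sections A. \<forall>v\<in>gen_sections A. G u v = G v u) \<and>
     (\<forall>u\<in>gen_sections A. \<forall>v\<in>gen_sections A. \<forall>w\<in>gen_sections A. G (u + v) w = G u w + G v w) \<and>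
     (\<forall>f\<in>smooth_functions A. \<forall>u\<in>gen_sections A. \<forall>v\<in>gen_sections A.
        G (gen_scale f u) v = f * G u v) \<and>
     (\<forall>p. \<forall>u\<in>gen_sections A. (\<forall>v\<in>gen_sections A. G u v p = 0) \<longrightarrow> vanishes_at A u p)"

definition positive_definite_at ::
    "('m::{t2_space,second_countable_topology}, 'e::euclidean_space) chart set \<Rightarrow>
     'm gen_form2 \<Rightarrow> 'm \<Rightarrow> bool" where
  "positive_definite_at A G p \<longleftrightarrow>
     (\<forall>u\<in>gen_sections A. \<not> vanishes_at A u p \<longrightarrow> G u u p > 0)"

definition non_positive_definite_metric ::
    "('m::{t2_space,second_countable_topology}, 'e::euclidean_space) chart set \<Rightarrow>
     'm gen_form2 \<Rightarrow> bool" where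
  "non_positive_definite_metric A G \<longleftrightarrow>
     gen_metric A G \<and> (\<forall>p. \<not> positive_definite_at A G p)"

definition gen_indefinite_almost_hermitian ::
    "('m::{t2_space,second_countable_topology}, 'e::euclidean_space) chart set \<Rightarrow>
     ('m gen_section \<Rightarrow> 'm gen_section) \<Rightarrow> 'm gen_form2 \<Rightarrow> bool" where
  "gen_indefinite_almost_hermitian A \<J> G \<longleftrightarrow>
     gen_almost_complex_structure A \<J> \<and> non_positive_definite_metric A G \<and>
     (\<forall>u\<in>gen_sections A. \<forall>v\<in>gen_sections A. G (\<J> u) (\<J> v) = G u v)"

definition gen_almost_norden ::
    "('m::{t2_space,second_countable_topology}, 'e::euclidean_space) chart set \<Rightarrow>
     ('m gen_section \<Rightarrow> 'm gen_section) \<Rightarrow> 'm gen_form2 \<Rightarrow> bool" where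
  "gen_almost_norden A \<J> G \<longleftrightarrow>
     gen_almost_complex_structure A \<J> \<and> non_positive_definite_metric A G \<and>
     (\<forall>u\<in>gen_sections A. \<forall>v\<in>gen_sections A. G (\<J> u) (\<J> v) = - G u v)"

definition fundamental_tensor ::
    "('m gen_section \<Rightarrow> 'm gen_section) \<Rightarrow> 'm gen_form2 \<Rightarrow> 'm gen_form2" where
  "fundamental_tensor \<J> G = (\<lambda>u v. G (\<J> u) v)"

end

theory Submission
  imports Defs
begin

text \<open>
  All identities are pointwise computations with \<open>J\<^sup>2 = -Id\<close>. Non-degeneracy of the natural metric
  is seen by pairing with \<open>(Y, 0)\<close> and with the exact sections \<open>(0, df)\<close>. The only analytic point
  is that the metric is not positive definite at any \<open>p\<close>: a vector field \<open>X\<close> is null, so one needs a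
  global vector field that does not vanish at \<open>p\<close>. It is a coordinate field cut off by a bump
  function built from \<open>exp (-1/t)\<close>, and it is detected by a cut-off coordinate function.
\<close>

section \<open>Calculus of \<open>C\<^sup>k\<close> maps\<close>

text \<open>On an open set the derivative at a point is determined by the values in the set, so each
  level of the recursion transfers. The hypothesis is symmetric in \<open>f\<close> and
  \<open>g\<close>, hence one implication, proved for arbitrary functions, is enough.\<close>

lemma Ck_on_cong:
  assumes "open S" "\<And>x. x \<in> S \<Longrightarrow> f x = g x"
  shows "Ck_on k S f \<longleftrightarrow> Ck_on k S g"
proof -
  have imp: "Ck_on k S h" if "Ck_on k S f" and eq: "\<And>x. x \<in> S \<Longrightarrow> f x = h x" for f h :: "'a \<Rightarrow> 'b"
    using that
  proof (induction k arbitrary: f h)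
    case 0
    then show ?case using continuous_on_cong[of S S f h] by simp
  next
    case (Suc k)
    have h: "(h has_derivative frechet_derivative f (at x)) (at x)" if x: "x \<in> S" for x
    proof (rule has_derivative_transform_within_open[OF _ assms(1) x])
      show "(f has_derivative frechet_derivative f (at x)) (at x)"
        using Suc.prems(1) x by (simp add: frechet_derivative_works[symmetric])
    qed (rule Suc.prems(2))
    have "Ck_on k S (\<lambda>x. frechet_derivative h (at x) v)" for v
      by (rule Suc.IH[of "\<lambda>x. frechet_derivative f (at x) v"])
         (use Suc.prems frechet_derivative_at[OF h] in auto)
    then show ?case using h by (auto simp: differentiable_def)
  qed
  show ?thesis using imp[of f g] imp[of g f] assms(2) by auto
qed

text \<open>Uniqueness of derivatives lets an explicit formula \<open>D\<close> replace
  \<open>frechet_derivative\<close>. The inductive steps of the closure rules below have this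
  form.\<close>

lemma Ck_on_has_derivativeI:
  assumes "open S" and D: "\<And>x. x \<in> S \<Longrightarrow> (f has_derivative D x) (at x)"
    and C: "\<And>v. Ck_on k S (\<lambda>x. D x v)"
  shows "Ck_on (Suc k) S f"
proof -
  have "Ck_on k S (\<lambda>x. frechet_derivative f (at x) v) \<longleftrightarrow> Ck_on k S (\<lambda>x. D x v)" for v
    by (rule Ck_on_cong[OF assms(1)]) (simp add: frechet_derivative_at[OF D, symmetric])
  then show ?thesis using C D by (auto simp: differentiable_def)
qed

lemma Ck_on_has_derivative:
  "Ck_on (Suc k) S f \<Longrightarrow> x \<in> S \<Longrightarrow> (f has_derivative frechet_derivative f (at x)) (at x)"
  by (simp add: frechet_derivative_works[symmetric])

lemma Ck_on_derivative: "Ck_on (Suc k) S f \<Longrightarrow> Ck_on k S (\<lambda>x. frechet_derivative f (at x) v)"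
  by simp

text \<open>Differentiability gives continuity at the bottom of the recursion. The lemma is what
  lets undifferentiated factors in the product and chain rules enter an induction hypothesis of
  order \<open>k\<close>.\<close>

lemma Ck_on_SucD: "Ck_on (Suc k) S f \<Longrightarrow> Ck_on k S f"
proof (induction k arbitrary: f)
  case 0
  then show ?case
    by (auto intro!: continuous_at_imp_continuous_on differentiable_imp_continuous_within)
next
  case (Suc k)
  then show ?case by simp
qed

lemma Ck_on_const: "Ck_on k S (\<lambda>x. c)"
  by (induction k arbitrary: c) auto

lemma Ck_on_add:
  assumes "open S" "Ck_on k S f" "Ck_on k S g"
  shows "Ck_on k S (\<lambda>x. f x + g x)"
  using assms(2,3)
proof (induction k arbitrary: f g)
  case 0
  then show ?case by (auto intro: continuous_on_add)
next
  case (Suc k)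
  show ?case
  proof (rule Ck_on_has_derivativeI[OF assms(1)])
    fix x assume x: "x \<in> S"
    show "((\<lambda>x. f x + g x) has_derivative
        (\<lambda>v. frechet_derivative f (at x) v + frechet_derivative g (at x) v)) (at x)"
      by (intro has_derivative_add Ck_on_has_derivative[OF _ x, of k] Suc.prems)
  next
    show "Ck_on k S (\<lambda>x. frechet_derivative f (at x) v + frechet_derivative g (at x) v)" for v
      by (intro Suc.IH Ck_on_derivative Suc.prems)
  qed
qed

lemma Ck_on_scaleR:
  assumes "open S" "Ck_on k S f" "Ck_on k S g"
  shows "Ck_on k S (\<lambda>x. f x *\<^sub>R g x)"
  using assms(2,3)
proof (induction k arbitrary: f g)
  case 0
  then show ?case by (auto intro: continuous_on_scaleR)
next
  case (Suc k)
  show ?case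
  proof (rule Ck_on_has_derivativeI[OF assms(1)])
    fix x assume x: "x \<in> S"
    show "((\<lambda>x. f x *\<^sub>R g x) has_derivative
        (\<lambda>v. f x *\<^sub>R frechet_derivative g (at x) v + frechet_derivative f (at x) v *\<^sub>R g x)) (at x)"
      by (intro has_derivative_scaleR Ck_on_has_derivative[OF _ x, of k] Suc.prems)
  next
    show "Ck_on k S
        (\<lambda>x. f x *\<^sub>R frechet_derivative g (at x) v + frechet_derivative f (at x) v *\<^sub>R g x)" for v
      by (intro Ck_on_add[OF assms(1)] Suc.IH Ck_on_derivative[OF Suc.prems(1)]
          Ck_on_derivative[OF Suc.prems(2)] Ck_on_SucD[OF Suc.prems(1)] Ck_on_SucD[OF Suc.prems(2)])
  qed
qed

lemma Ck_on_mult: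
  fixes f g :: "'e::euclidean_space \<Rightarrow> real"
  assumes "open S" "Ck_on k S f" "Ck_on k S g"
  shows "Ck_on k S (\<lambda>x. f x * g x)"
  using Ck_on_scaleR[OF assms] by simp

lemma Ck_on_sum:
  assumes "open S" "\<And>i. i \<in> I \<Longrightarrow> Ck_on k S (f i)"
  shows "Ck_on k S (\<lambda>x. \<Sum>i\<in>I. f i x)"
proof (cases "finite I")
  case True
  then show ?thesis using assms(2)
    by (induction I) (auto intro: Ck_on_add[OF assms(1)] Ck_on_const)
qed (simp add: Ck_on_const)

lemma Ck_on_bounded_linear:
  assumes "open S" "bounded_linear L" "Ck_on k S f"
  shows "Ck_on k S (\<lambda>x. L (f x))"
  using assms(3)
proof (induction k arbitrary: f)
  case 0
  then show ?case by (auto intro: bounded_linear.continuous_on[OF assms(2)])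
next
  case (Suc k)
  show ?case
  proof (rule Ck_on_has_derivativeI[OF assms(1)])
    fix x assume x: "x \<in> S"
    show "((\<lambda>x. L (f x)) has_derivative (\<lambda>v. L (frechet_derivative f (at x) v))) (at x)"
      by (intro bounded_linear.has_derivative[OF assms(2)] Ck_on_has_derivative[OF _ x, of k] Suc.prems)
  next
    show "Ck_on k S (\<lambda>x. L (frechet_derivative f (at x) v))" for v
      by (intro Suc.IH Ck_on_derivative Suc.prems)
  qed
qed

lemma Ck_on_id: "open S \<Longrightarrow> Ck_on k S (\<lambda>x. x)"
proof (cases k)
  case (Suc n)
  assume "open S"
  then show ?thesis unfolding Suc
    by (rule Ck_on_has_derivativeI) (auto intro: Ck_on_const has_derivative_ident)
qed auto

text \<open>The chain rule is expanded in a basis, so that only products and sums of lower order occur.\<close>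

lemma Ck_on_compose:
  fixes f :: "'e::euclidean_space \<Rightarrow> 'f::euclidean_space"
  assumes "open S" "f ` S \<subseteq> T" "Ck_on k S f" "Ck_on k T g"
  shows "Ck_on k S (\<lambda>x. g (f x))"
  using assms(3,4)
proof (induction k arbitrary: g)
  case 0
  then show ?case using assms(2) by (auto intro: continuous_on_compose2)
next
  case (Suc k)
  have fT: "f x \<in> T" if "x \<in> S" for x using assms(2) that by auto
  show ?case
  proof (rule Ck_on_has_derivativeI[OF assms(1)])
    fix x assume x: "x \<in> S"
    let ?Df = "frechet_derivative f (at x)" and ?Dg = "frechet_derivative g (at (f x))"
    have g: "(g has_derivative ?Dg) (at (f x))"
      by (rule Ck_on_has_derivative[OF Suc.prems(2) fT[OF x]])
    have Dg: "?Dg w = (\<Sum>i\<in>Basis. (w \<bullet> i) *\<^sub>R ?Dg i)" for w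
    proof -
      have lin: "linear ?Dg" using g by (rule has_derivative_linear)
      have "?Dg (\<Sum>i\<in>Basis. (w \<bullet> i) *\<^sub>R i) = (\<Sum>i\<in>Basis. (w \<bullet> i) *\<^sub>R ?Dg i)"
        by (simp only: linear_sum[OF lin] linear_scale[OF lin])
      then show ?thesis by (simp only: euclidean_representation)
    qed
    show "((\<lambda>x. g (f x)) has_derivative
        (\<lambda>v. \<Sum>i\<in>Basis. (?Df v \<bullet> i) *\<^sub>R ?Dg i)) (at x)"
      by (rule has_derivative_eq_rhs[OF has_derivative_compose[OF
              Ck_on_has_derivative[OF Suc.prems(1) x] g]]) (rule ext, rule Dg)
  next
    fix v
    show "Ck_on k S (\<lambda>x. \<Sum>i\<in>Basis.
        (frechet_derivative f (at x) v \<bullet> i) *\<^sub>R frechet_derivative g (at (f x)) i)"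
    proof (rule Ck_on_sum[OF assms(1)], rule Ck_on_scaleR[OF assms(1)])
      fix i :: 'f
      show "Ck_on k S (\<lambda>x. frechet_derivative f (at x) v \<bullet> i)"
        by (rule Ck_on_bounded_linear[OF assms(1) bounded_linear_inner_left
              Ck_on_derivative[OF Suc.prems(1)]])
      \<comment> \<open>Only \<open>g\<close> varies in the induction: the hypothesis is applied to
        a directional derivative of \<open>g\<close>, with \<open>f\<close> kept and its class
        lowered by one.\<close>
      show "Ck_on k S (\<lambda>x. frechet_derivative g (at (f x)) i)"
        by (rule Suc.IH[OF Ck_on_SucD[OF Suc.prems(1)] Ck_on_derivative[OF Suc.prems(2)]])
    qed
  qed
qed

lemma Ck_on_subset: "Ck_on k S f \<Longrightarrow> T \<subseteq> S \<Longrightarrow> Ck_on k T f"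
  by (induction k arbitrary: f) (auto intro: continuous_on_subset)

text \<open>Differentiability is tested with the full filter \<open>at x\<close>, so it passes to
  unions directly. Openness serves the continuity at the bottom of the recursion.\<close>

lemma Ck_on_Un:
  "open S \<Longrightarrow> open T \<Longrightarrow> Ck_on k S f \<Longrightarrow> Ck_on k T f \<Longrightarrow> Ck_on k (S \<union> T) f"
  by (induction k arbitrary: f) (auto intro: continuous_on_open_Un)

lemma smooth_on_derivative: "smooth_on S f \<Longrightarrow> smooth_on S (\<lambda>x. frechet_derivative f (at x) v)"
  unfolding smooth_on_def by (auto intro: Ck_on_derivative)

lemma smooth_on_has_derivative:
  "smooth_on S f \<Longrightarrow> x \<in> S \<Longrightarrow> (f has_derivative frechet_derivative f (at x)) (at x)"
  unfolding smooth_on_def using Ck_on_has_derivative[of 0] by blast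

section \<open>Bump functions\<close>

text \<open>The power of \<open>inverse t\<close> makes the family closed under differentiation up
  to linear combinations, so smoothness of exp (-1/t), the case \<open>n = 0\<close>, follows by
  induction over all \<open>n\<close> at once.\<close>

definition flat :: "nat \<Rightarrow> real \<Rightarrow> real" where
  "flat n t = (if t > 0 then inverse t ^ n * exp (- inverse t) else 0)"

text \<open>From the right, the substitution s = 1/t turns the claim into s^n / exp s tending to 0
  at infinity; from the left the function is 0.\<close>

lemma flat_tendsto_0: "(flat n \<longlongrightarrow> 0) (at 0)"
proof (rule filterlim_split_at)
  show "(flat n \<longlongrightarrow> 0) (at_left 0)"
    by (rule tendsto_eventually) (auto simp: flat_def eventually_at_filter)
  have "((\<lambda>t. inverse t ^ n / exp (inverse t)) \<longlongrightarrow> (0::real)) (at_right 0)"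
    by (rule filterlim_compose[OF tendsto_power_div_exp_0 filterlim_inverse_at_top_right])
  then show "(flat n \<longlongrightarrow> 0) (at_right 0)"
    by (rule Lim_transform_eventually)
       (auto simp: flat_def exp_minus field_simps eventually_at_filter)
qed

lemma flat_has_derivative:
  "(flat n has_real_derivative (flat (n + 2) t - real n * flat (n + 1) t)) (at t)"
proof -
  consider "t > 0" | "t < 0" | "t = 0" by linarith
  then show ?thesis
  proof cases
    case 1
    have "((\<lambda>t. inverse t ^ n) has_real_derivative - real n * inverse t ^ (n + 1)) (at t)"
    \<comment> \<open>The power rule yields the natural-number exponent \<open>n - 1\<close>, so
      \<open>n = 0\<close> is split off.\<close>
    proof (cases n)
      case (Suc m)
      show ?thesis unfolding Suc
        by (rule DERIV_cong[OF DERIV_power[OF DERIV_inverse]]) (use 1 in \<open>auto simp: algebra_simps\<close>)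
    qed simp
    moreover have "((\<lambda>t. exp (- inverse t)) has_real_derivative exp (- inverse t) * inverse t ^ 2) (at t)"
      using 1 by (auto intro!: derivative_eq_intros simp: field_simps power2_eq_square)
    ultimately have "((\<lambda>t. inverse t ^ n * exp (- inverse t)) has_real_derivative
        (flat (n + 2) t - real n * flat (n + 1) t)) (at t)"
      by (rule DERIV_cong[OF DERIV_mult])
         (use 1 in \<open>simp add: flat_def algebra_simps power_add power2_eq_square\<close>)
    then show ?thesis
      by (rule has_field_derivative_transform_within_open[where S="{0<..}"])
         (use 1 in \<open>auto simp: flat_def\<close>)
  next
    case 2
    have "((\<lambda>t. 0) has_real_derivative 0) (at t)" by simp
    then have "(flat n has_real_derivative 0) (at t)"
      by (rule has_field_derivative_transform_within_open[where S="{..<0}"])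
         (use 2 in \<open>auto simp: flat_def\<close>)
    then show ?thesis using 2 by (simp add: flat_def)
  next
    case 3
    \<comment> \<open>Since \<open>flat n 0 = 0\<close>, the difference quotient at 0 is
      \<open>flat (Suc n) h\<close>, and the previous limit applies.\<close>
    have "((\<lambda>h. (flat n (0 + h) - flat n 0) / h) \<longlongrightarrow> 0) (at 0)"
      using flat_tendsto_0[of "Suc n"]
      by (rule Lim_transform_eventually) (auto simp: flat_def divide_inverse eventually_at_filter)
    then show ?thesis using 3 by (simp add: DERIV_def flat_def)
  qed
qed

lemma Ck_on_flat: "Ck_on k UNIV (flat n)"
proof (induction k arbitrary: n)
  case 0
  then show ?case
    by (auto intro!: continuous_at_imp_continuous_on DERIV_isCont[OF flat_has_derivative])
next
  case (Suc k)
  show ?case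
  proof (rule Ck_on_has_derivativeI[OF open_UNIV])
    show "(flat n has_derivative (\<lambda>v. (flat (n + 2) x + (- real n) * flat (n + 1) x) * v)) (at x)" for x
      using flat_has_derivative[of n x] by (simp add: has_field_derivative_def)
    show "Ck_on k UNIV (\<lambda>x. (flat (n + 2) x + (- real n) * flat (n + 1) x) * v)" for v
      by (intro Ck_on_mult Ck_on_add Ck_on_const Suc.IH open_UNIV)
  qed
qed

text \<open>The squared distance is used because it is polynomial in the coordinates, hence smooth
  at the centre too, where the norm is not.\<close>

definition bump :: "'e::euclidean_space \<Rightarrow> real \<Rightarrow> 'e \<Rightarrow> real" where
  "bump a r x = flat 0 (r\<^sup>2 - (x - a) \<bullet> (x - a))"

lemma Ck_on_coordinate: "open S \<Longrightarrow> Ck_on k S (\<lambda>x. (x - a) \<bullet> v)"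
proof (rule Ck_on_bounded_linear[OF _ bounded_linear_inner_left])
  assume S: "open S"
  show "Ck_on k S (\<lambda>x. x - a)"
    using Ck_on_add[OF S Ck_on_id[OF S] Ck_on_const, of k "- a"] by simp
qed

lemma Ck_on_bump: "Ck_on k UNIV (bump a r)"
proof -
  \<comment> \<open>Expanding in the basis, with the difference written as a sum, leaves only
    constants, coordinates, sums and products.\<close>
  have eq: "r\<^sup>2 - (x - a) \<bullet> (x - a) = r\<^sup>2 + (- 1) * (\<Sum>i\<in>Basis. ((x - a) \<bullet> i) * ((x - a) \<bullet> i))" for x
    by (subst euclidean_inner) simp
  have "Ck_on k UNIV (\<lambda>x. r\<^sup>2 - (x - a) \<bullet> (x - a))"
    unfolding eq
    by (intro Ck_on_add Ck_on_mult Ck_on_sum Ck_on_const Ck_on_coordinate open_UNIV)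
  from Ck_on_compose[OF open_UNIV _ this Ck_on_flat] show ?thesis
    unfolding bump_def[abs_def] by auto
qed

lemma bump_outside:
  assumes "x \<notin> cball a r" "r > 0"
  shows "bump a r x = 0"
proof -
  have "r < norm (x - a)" using assms by (simp add: dist_norm norm_minus_commute)
  then have "r\<^sup>2 < (norm (x - a))\<^sup>2" using assms(2) by (intro power_strict_mono) auto
  then show ?thesis by (simp add: bump_def flat_def power2_norm_eq_inner)
qed

lemma bump_center_pos: "r > 0 \<Longrightarrow> bump a r a > 0"
  by (simp add: bump_def flat_def)

section \<open>Smooth functions and vector fields on the manifold\<close>

lemma smooth_atlas_chartD:
  assumes "smooth_atlas A" "(U, \<phi>) \<in> A"
  shows "open U" "open (\<phi> ` U)" "homeomorphism U (\<phi> ` U) \<phi> (inv_into U \<phi>)"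
  using assms unfolding smooth_atlas_def by auto

lemma smooth_atlas_transition:
  assumes "smooth_atlas A" "(U, \<phi>) \<in> A" "(V, \<psi>) \<in> A"
  shows "smooth_on (\<phi> ` (U \<inter> V)) (\<psi> \<circ> inv_into U \<phi>)"
  using assms unfolding smooth_atlas_def by fast

text \<open>The image is the preimage of \<open>W\<close> under the continuous inverse
  \<open>g\<close> on the open set \<open>T\<close>.\<close>

lemma homeomorphism_open_image:
  assumes "homeomorphism S T f g" "open T" "open W"
  shows "open (f ` (S \<inter> W))"
proof -
  have "f ` (S \<inter> W) = T \<inter> g -` W"
    using assms(1) unfolding homeomorphism_def by force
  then show ?thesis
    using assms continuous_open_preimage unfolding homeomorphism_def by metis
qed

lemma smooth_functionsI:
  "(\<And>U \<phi>. (U, \<phi>) \<in> A \<Longrightarrow> smooth_on (\<phi> ` U) (\<lambda>x. f (inv_into U \<phi> x))) \<Longrightarrow> f \<in> smooth_functions A"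
  by (auto simp: smooth_functions_def comp_def)

lemma smooth_functionsD:
  "f \<in> smooth_functions A \<Longrightarrow> (U, \<phi>) \<in> A \<Longrightarrow> smooth_on (\<phi> ` U) (\<lambda>x. f (inv_into U \<phi> x))"
  by (auto simp: smooth_functions_def comp_def)

lemma smooth_functions_const: "(\<lambda>_. c) \<in> smooth_functions A"
  by (rule smooth_functionsI) (simp add: smooth_on_def Ck_on_const)

lemma smooth_functions_0: "0 \<in> smooth_functions A"
  using smooth_functions_const[of 0] by (simp add: zero_fun_def)

lemma smooth_functions_add:
  assumes "smooth_atlas A" "f \<in> smooth_functions A" "g \<in> smooth_functions A"
  shows "f + g \<in> smooth_functions A"
proof (rule smooth_functionsI)
  fix U \<phi> assume c: "(U, \<phi>) \<in> A"
  show "smooth_on (\<phi> ` U) (\<lambda>x. (f + g) (inv_into U \<phi> x))"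
    using smooth_functionsD[OF assms(2) c] smooth_functionsD[OF assms(3) c]
    by (auto simp: smooth_on_def intro: Ck_on_add smooth_atlas_chartD(2)[OF assms(1) c])
qed

lemma smooth_functions_mult:
  assumes "smooth_atlas A" "f \<in> smooth_functions A" "g \<in> smooth_functions A"
  shows "f * g \<in> smooth_functions A"
proof (rule smooth_functionsI)
  fix U \<phi> assume c: "(U, \<phi>) \<in> A"
  show "smooth_on (\<phi> ` U) (\<lambda>x. (f * g) (inv_into U \<phi> x))"
    using smooth_functionsD[OF assms(2) c] smooth_functionsD[OF assms(3) c]
    by (auto simp: smooth_on_def intro: Ck_on_mult smooth_atlas_chartD(2)[OF assms(1) c])
qed

text \<open>
  In another chart \<open>\<psi>\<close> the extended function is \<open>w\<close> composed with a transition map on the overlap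
  and zero off the preimage of the ball; that preimage is compact, hence closed.
\<close>

lemma smooth_functions_extend_by_0:
  fixes A :: "('m::{t2_space,second_countable_topology}, 'e::euclidean_space) chart set"
  assumes A: "smooth_atlas A" and c: "(U, \<phi>) \<in> A"
    and w: "smooth_on (\<phi> ` U) w"
    and K: "compact K" "K \<subseteq> \<phi> ` U"
    and w0: "\<And>x. x \<notin> K \<Longrightarrow> w x = 0"
  shows "(\<lambda>q. if q \<in> U then w (\<phi> q) else 0) \<in> smooth_functions A" (is "?f \<in> _")
proof (rule smooth_functionsI)
  fix V \<psi> assume d: "(V, \<psi>) \<in> A"
  note U = smooth_atlas_chartD[OF A c] and V = smooth_atlas_chartD[OF A d]
  let ?i = "inv_into U \<phi>" and ?j = "inv_into V \<psi>"
  let ?C = "?i ` K"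
  have "compact ?C"
    using K U(3) unfolding homeomorphism_def
    by (meson compact_continuous_image continuous_on_subset)
  then have "closed ?C" by (rule compact_imp_closed)
  have jV: "?j (\<psi> q) = q" if "q \<in> V" for q
    using V(3) that unfolding homeomorphism_def by auto
  have iU: "?i (\<phi> q) = q" if "q \<in> U" for q
    using U(3) that unfolding homeomorphism_def by auto
  let ?S = "\<psi> ` (V \<inter> U)" and ?T = "\<psi> ` (V \<inter> - ?C)"
  have S: "open ?S" by (rule homeomorphism_open_image[OF V(3,2) U(1)])
  have T: "open ?T"
    by (rule homeomorphism_open_image[OF V(3,2)]) (use \<open>closed ?C\<close> in auto)
  have "?C \<subseteq> U" using K(2) iU by auto
  then have "V = (V \<inter> U) \<union> (V \<inter> - ?C)" by blast
  then have un: "\<psi> ` V = ?S \<union> ?T" by (metis image_Un)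
  have "Ck_on k ?S (\<lambda>x. ?f (?j x))" for k
  proof -
    have "Ck_on k ?S (\<lambda>x. w ((\<phi> \<circ> ?j) x))"
    proof (rule Ck_on_compose[OF S, where f="\<phi> \<circ> ?j" and g=w])
      show "Ck_on k ?S (\<phi> \<circ> ?j)"
        using smooth_atlas_transition[OF A d c] by (simp add: smooth_on_def)
      show "Ck_on k (\<phi> ` U) w" using w by (simp add: smooth_on_def)
      show "(\<phi> \<circ> ?j) ` ?S \<subseteq> \<phi> ` U" using jV by auto
    qed
    moreover have "Ck_on k ?S (\<lambda>x. ?f (?j x)) \<longleftrightarrow> Ck_on k ?S (\<lambda>x. w ((\<phi> \<circ> ?j) x))"
      by (rule Ck_on_cong[OF S]) (auto simp: jV)
    ultimately show ?thesis by blast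
  qed
  moreover have "Ck_on k ?T (\<lambda>x. ?f (?j x)) \<longleftrightarrow> Ck_on k ?T (\<lambda>x. 0::real)" for k
  proof (rule Ck_on_cong[OF T])
    fix x assume "x \<in> ?T"
    then obtain q where q: "x = \<psi> q" "q \<in> V" "q \<notin> ?C" by auto
    have "\<phi> q \<notin> K" if "q \<in> U" using q(3) iU[OF that] by force
    then show "?f (?j x) = 0" using q w0 jV by auto
  qed
  ultimately show "smooth_on (\<psi> ` V) (\<lambda>x. ?f (?j x))"
    unfolding smooth_on_def un by (intro allI Ck_on_Un S T) (simp_all add: Ck_on_const)
qed

section \<open>Cut-off coordinate vector fields\<close>

definition coordinate_field ::
    "('m::{t2_space,second_countable_topology}, 'e::euclidean_space) chart set \<Rightarrow>
     'm set \<Rightarrow> ('m \<Rightarrow> 'e) \<Rightarrow> ('e \<Rightarrow> real) \<Rightarrow> 'e \<Rightarrow> 'm field" where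
  "coordinate_field A U \<phi> b v = (\<lambda>f q. if f \<in> smooth_functions A \<and> q \<in> U
     then b (\<phi> q) * frechet_derivative (\<lambda>x. f (inv_into U \<phi> x)) (at (\<phi> q)) v else 0)"

text \<open>Inside the chart the derivation laws are those of a directional derivative multiplied by
  \<open>b\<close>; outside everything is 0. Smoothness of the result comes from extension by zero,
  as \<open>b\<close> vanishes off the compact set \<open>K\<close>.\<close>

lemma coordinate_field_vector_field:
  fixes A :: "('m::{t2_space,second_countable_topology}, 'e::euclidean_space) chart set"
  assumes A: "smooth_atlas A" and c: "(U, \<phi>) \<in> A"
    and b: "smooth_on (\<phi> ` U) b"
    and K: "compact K" "K \<subseteq> \<phi> ` U"
    and b0: "\<And>x. x \<notin> K \<Longrightarrow> b x = 0"
  shows "coordinate_field A U \<phi> b v \<in> vector_fields A" (is "?X \<in> _")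
proof -
  note U = smooth_atlas_chartD[OF A c]
  let ?D = "\<lambda>f. frechet_derivative (\<lambda>x. f (inv_into U \<phi> x))"
  have iU: "inv_into U \<phi> (\<phi> q) = q" if "q \<in> U" for q
    using U(3) that unfolding homeomorphism_def by auto
  have der: "((\<lambda>x. f (inv_into U \<phi> x)) has_derivative ?D f (at (\<phi> q))) (at (\<phi> q))"
    if "f \<in> smooth_functions A" "q \<in> U" for f q
    by (rule smooth_on_has_derivative[OF smooth_functionsD[OF that(1) c]]) (use that in auto)
  have D_add: "frechet_derivative (\<lambda>x. f (inv_into U \<phi> x) + g (inv_into U \<phi> x)) (at (\<phi> q)) v =
       ?D f (at (\<phi> q)) v + ?D g (at (\<phi> q)) v"
    if "f \<in> smooth_functions A" "g \<in> smooth_functions A" "q \<in> U" for f g q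
    using frechet_derivative_at[OF has_derivative_add[OF der[OF that(1,3)] der[OF that(2,3)]]]
    by (simp add: fun_eq_iff)
  have D_mult: "frechet_derivative (\<lambda>x. f (inv_into U \<phi> x) * g (inv_into U \<phi> x)) (at (\<phi> q)) v =
       f q * ?D g (at (\<phi> q)) v + ?D f (at (\<phi> q)) v * g q"
    if "f \<in> smooth_functions A" "g \<in> smooth_functions A" "q \<in> U" for f g q
    using frechet_derivative_at[OF has_derivative_mult[OF der[OF that(1,3)] der[OF that(2,3)]]]
    by (simp add: fun_eq_iff iU that)
  have X_smooth: "?X f \<in> smooth_functions A" if f: "f \<in> smooth_functions A" for f
  proof -
    have "smooth_on (\<phi> ` U) (\<lambda>x. b x * ?D f (at x) v)"
      using b smooth_on_derivative[OF smooth_functionsD[OF f c]] Ck_on_mult[OF U(2)]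
      unfolding smooth_on_def by blast
    from smooth_functions_extend_by_0[OF A c this K] show ?thesis
      using f b0 by (simp add: coordinate_field_def)
  qed
  have X_mult: "?X (f * g) = ?X f * g + f * ?X g"
    if "f \<in> smooth_functions A" "g \<in> smooth_functions A" for f g
    using that
    by (auto simp: coordinate_field_def fun_eq_iff D_mult smooth_functions_mult[OF A] algebra_simps)
  have X_const: "?X (\<lambda>_. c) = 0" for c
    by (simp add: coordinate_field_def fun_eq_iff)
  show ?thesis
    unfolding vector_fields_def
  proof (safe, goal_cases)
    case (2 f g)
    then show ?case
      by (auto simp: coordinate_field_def fun_eq_iff D_add smooth_functions_add[OF A] algebra_simps)
  next
    \<comment> \<open>Homogeneity follows from the Leibniz rule with a constant factor, since the
      field kills constants.\<close>
    case (3 c f)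
    then show ?case by (simp add: X_mult[OF smooth_functions_const] X_const)
  next
    case (5 f)
    then show ?case by (simp add: coordinate_field_def fun_eq_iff)
  qed (simp_all add: X_smooth X_mult)
qed

lemma exists_nonvanishing_vector_field:
  fixes A :: "('m::{t2_space,second_countable_topology}, 'e::euclidean_space) chart set"
  assumes A: "smooth_atlas A"
  shows "\<exists>X\<in>vector_fields A. \<exists>f\<in>smooth_functions A. X f p \<noteq> 0"
proof -
  have "p \<in> (\<Union>(U, \<phi>)\<in>A. U)" using A unfolding smooth_atlas_def by simp
  then obtain U \<phi> where c: "(U, \<phi>) \<in> A" and p: "p \<in> U" by auto
  note U = smooth_atlas_chartD[OF A c]
  obtain r where r: "r > 0" "cball (\<phi> p) r \<subseteq> \<phi> ` U"
    using U(2) p open_contains_cball by blast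
  obtain v :: 'e where v: "v \<in> Basis" using nonempty_Basis by blast
  let ?b = "bump (\<phi> p) r"
  \<comment> \<open>The coordinate in direction \<open>v\<close>, centred at the image of
    \<open>p\<close>, is cut off by the same bump so that it extends by zero to a global
    function.\<close>
  define w where "w x = ?b x * ((x - \<phi> p) \<bullet> v)" for x
  define f where "f q = (if q \<in> U then w (\<phi> q) else 0)" for q
  have b: "smooth_on (\<phi> ` U) ?b"
    using Ck_on_subset[OF Ck_on_bump] by (auto simp: smooth_on_def)
  have "smooth_on (\<phi> ` U) w"
    using b Ck_on_mult[OF U(2)] Ck_on_coordinate[OF U(2)]
    unfolding smooth_on_def w_def by blast
  from smooth_functions_extend_by_0[OF A c this compact_cball r(2)]
  have f: "f \<in> smooth_functions A"
    unfolding f_def[abs_def] by (simp add: w_def bump_outside[OF _ r(1)])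
  let ?X = "coordinate_field A U \<phi> ?b v"
  have X: "?X \<in> vector_fields A"
    by (rule coordinate_field_vector_field[OF A c b compact_cball r(2)])
       (rule bump_outside[OF _ r(1)])
  have b': "(?b has_derivative frechet_derivative ?b (at (\<phi> p))) (at (\<phi> p))"
    by (rule smooth_on_has_derivative[OF b]) (use p in auto)
  \<comment> \<open>At \<phi> p the coordinate factor is 0, so the term containing the derivative of
    the bump drops out and that derivative need not be computed.\<close>
  have "(w has_derivative (\<lambda>u. ?b (\<phi> p) * (u \<bullet> v))) (at (\<phi> p))"
    unfolding w_def by (rule derivative_eq_intros b' refl | simp)+
  then have "((\<lambda>x. f (inv_into U \<phi> x)) has_derivative (\<lambda>u. ?b (\<phi> p) * (u \<bullet> v))) (at (\<phi> p))"
  proof (rule has_derivative_transform_within_open[OF _ U(2)])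
    show "w x = f (inv_into U \<phi> x)" if "x \<in> \<phi> ` U" for x
      using that by (auto simp: f_def inv_into_into f_inv_into_f)
  qed (use p in auto)
  \<comment> \<open>One factor \<open>?b (\<phi> p)\<close> comes from the field, the other from
    \<open>w\<close>; both are positive, and v \<bullet> v = 1 for a basis vector.\<close>
  from frechet_derivative_at[OF this] have "?X f p = ?b (\<phi> p) * (?b (\<phi> p) * (v \<bullet> v))"
    using f p by (simp add: coordinate_field_def fun_eq_iff)
  then have "?X f p \<noteq> 0"
    using bump_center_pos[OF r(1), of "\<phi> p"] v by (simp add: inner_Basis)
  with X f show ?thesis by blast
qed

section \<open>The natural metric and the structures \<open>\<J>\<^bsub>\<lambda>,J\<^esub>\<close>\<close>

lemma vector_fields_0: "0 \<in> vector_fields A"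
  by (simp add: vector_fields_def smooth_functions_0)

lemma vector_fields_add:
  "smooth_atlas A \<Longrightarrow> X \<in> vector_fields A \<Longrightarrow> Y \<in> vector_fields A \<Longrightarrow> X + Y \<in> vector_fields A"
  unfolding vector_fields_def by (auto simp: smooth_functions_add algebra_simps)

lemma vector_fields_fscale:
  "smooth_atlas A \<Longrightarrow> f \<in> smooth_functions A \<Longrightarrow> X \<in> vector_fields A \<Longrightarrow> fscale f X \<in> vector_fields A"
  unfolding vector_fields_def fscale_def by (auto simp: smooth_functions_mult algebra_simps)

lemma one_forms_0: "0 \<in> one_forms A"
  by (simp add: one_forms_def smooth_functions_0)

lemma one_forms_fscale:
  "smooth_atlas A \<Longrightarrow> f \<in> smooth_functions A \<Longrightarrow> \<xi> \<in> one_forms A \<Longrightarrow> fscale f \<xi> \<in> one_forms A"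
  \<comment> \<open>Only the multiple of \<xi> is unfolded; multiples of vector fields must stay
    intact to match the linearity of \<xi>.\<close>
  unfolding one_forms_def fscale_def[of f \<xi>] by (auto simp: smooth_functions_mult algebra_simps)

lemma one_form_smooth: "\<xi> \<in> one_forms A \<Longrightarrow> X \<in> vector_fields A \<Longrightarrow> \<xi> X \<in> smooth_functions A"
  by (simp add: one_forms_def)

lemma one_form_add:
  "\<xi> \<in> one_forms A \<Longrightarrow> X \<in> vector_fields A \<Longrightarrow> Y \<in> vector_fields A \<Longrightarrow> \<xi> (X + Y) = \<xi> X + \<xi> Y"
  by (simp add: one_forms_def)

lemma one_form_fscale:
  "\<xi> \<in> one_forms A \<Longrightarrow> f \<in> smooth_functions A \<Longrightarrow> X \<in> vector_fields A \<Longrightarrow> \<xi> (fscale f X) = f * \<xi> X"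
  by (simp add: one_forms_def)

lemma one_form_outside: "\<xi> \<in> one_forms A \<Longrightarrow> X \<notin> vector_fields A \<Longrightarrow> \<xi> X = 0"
  by (simp add: one_forms_def)

text \<open>Negation is multiplication by the constant function -1, so this is an instance of
  function-linearity.\<close>

lemma one_form_uminus:
  assumes "\<xi> \<in> one_forms A" "X \<in> vector_fields A"
  shows "\<xi> (- X) = - \<xi> X"
proof -
  have "- X = fscale (\<lambda>_. - 1) X" by (simp add: fscale_def fun_eq_iff)
  then show ?thesis
    using one_form_fscale[OF assms(1) smooth_functions_const assms(2), of "- 1"]
    by (simp add: fun_eq_iff[of _ "- \<xi> X"])
qed

lemma one_form_zero: "\<xi> \<in> one_forms A \<Longrightarrow> \<xi> 0 = 0"
  using one_form_add[OF _ vector_fields_0 vector_fields_0] by force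

text \<open>The exact form df. The value 0 off \<open>vector_fields A\<close> is the normalisation
  demanded by \<open>one_forms\<close>.\<close>

definition differential ::
    "('m::{t2_space,second_countable_topology}, 'e::euclidean_space) chart set \<Rightarrow>
     ('m \<Rightarrow> real) \<Rightarrow> 'm form" where
  "differential A f = (\<lambda>X. if X \<in> vector_fields A then X f else 0)"

lemma differential_one_form:
  assumes "smooth_atlas A" "f \<in> smooth_functions A"
  shows "differential A f \<in> one_forms A"
proof -
  have "X f \<in> smooth_functions A" if "X \<in> vector_fields A" for X
    using that assms(2) by (simp add: vector_fields_def)
  then show ?thesis
    using vector_fields_add[OF assms(1)] vector_fields_fscale[OF assms(1)]
    by (auto simp: one_forms_def differential_def fscale_def)
qed

section \<open>The natural metric\<close>

lemma natural_metric_gen_metric: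
  assumes A: "smooth_atlas A"
  shows "gen_metric A natural_metric"
proof -
  have smooth: "natural_metric (X, \<xi>) (Y, \<eta>) \<in> smooth_functions A"
    if "X \<in> vector_fields A" "Y \<in> vector_fields A" "\<xi> \<in> one_forms A" "\<eta> \<in> one_forms A"
    for X Y \<xi> \<eta>
  proof -
    have "natural_metric (X, \<xi>) (Y, \<eta>) = (\<lambda>_. 1/2) * (\<xi> Y + \<eta> X)"
      by (simp add: natural_metric_def fun_eq_iff)
    then show ?thesis
      using that by (simp add: smooth_functions_mult[OF A smooth_functions_const]
          smooth_functions_add[OF A] one_form_smooth)
  qed
  have nondeg: "vanishes_at A (X, \<xi>) p"
    if X: "X \<in> vector_fields A" and \<xi>: "\<xi> \<in> one_forms A"
      and 0: "\<And>Y \<eta>. Y \<in> vector_fields A \<Longrightarrow> \<eta> \<in> one_forms A \<Longrightarrow> natural_metric (X, \<xi>) (Y, \<eta>) p = 0"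
    for X \<xi> p
  proof -
    \<comment> \<open>Pairing with (0, df) leaves half of \<open>X f p\<close>, because the other
      half contains \<open>\<xi> 0\<close>.\<close>
    have "X f p = 0" if "f \<in> smooth_functions A" for f
      using 0[OF vector_fields_0 differential_one_form[OF A that]] X
      by (simp add: natural_metric_def differential_def one_form_zero[OF \<xi>])
    moreover have "\<xi> Y p = 0" if "Y \<in> vector_fields A" for Y
      using 0[OF that one_forms_0] by (simp add: natural_metric_def)
    ultimately show ?thesis by (simp add: vanishes_at_def)
  qed
  show ?thesis
    unfolding gen_metric_def gen_sections_def
  proof (safe, goal_cases)
    case 1
    then show ?case by (simp add: smooth)
  next
    case 2
    then show ?case by (simp add: natural_metric_def fun_eq_iff)
  next
    case 3
    then show ?case by (simp add: natural_metric_def fun_eq_iff one_form_add field_simps)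
  next
    case 4
    then show ?case
      \<comment> \<open>Linearity of the 1-forms must be applied while \<open>fscale\<close> is
        still folded; only then is it expanded.\<close>
      by (simp add: natural_metric_def gen_scale_def fun_eq_iff one_form_fscale)
         (simp add: fscale_def algebra_simps)
  next
    case 5
    then show ?case by (intro nondeg) auto
  qed
qed

lemma natural_metric_non_positive_definite:
  assumes A: "smooth_atlas A"
  shows "non_positive_definite_metric A natural_metric"
proof -
  have "\<not> positive_definite_at A natural_metric p" for p
  proof -
    obtain X f where X: "X \<in> vector_fields A" "f \<in> smooth_functions A" "X f p \<noteq> 0"
      using exists_nonvanishing_vector_field[OF A] by blast
    have "(X, 0) \<in> gen_sections A" using X one_forms_0 by (simp add: gen_sections_def)
    moreover have "\<not> vanishes_at A (X, 0) p" using X by (auto simp: vanishes_at_def)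
    moreover have "natural_metric (X, 0) (X, 0) p = 0" by (simp add: natural_metric_def)
    ultimately show ?thesis unfolding positive_definite_at_def by force
  qed
  then show ?thesis
    using natural_metric_gen_metric[OF A] by (simp add: non_positive_definite_metric_def)
qed

section \<open>The block structures and their compatibility with the metric\<close>

lemma gen_J_apply: "gen_J A l J (X, \<xi>) = (J X, fscale (\<lambda>_. l) (dual_map A J \<xi>))"
  by (simp add: gen_J_def block_matrix_def)

lemma dual_map_one_form:
  assumes "smooth_atlas A" "almost_complex_structure A J" "\<xi> \<in> one_forms A"
  shows "dual_map A J \<xi> \<in> one_forms A"
  using assms(2,3) vector_fields_add[OF assms(1)] vector_fields_fscale[OF assms(1)]
  by (auto simp: one_forms_def[of A] dual_map_def almost_complex_structure_def)

text \<open>On 1-forms the square is l^2 times the dual of J^2, that is -Id; the assumption on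
  \<open>l\<close> covers both signs.\<close>

lemma gen_J_almost_complex:
  assumes A: "smooth_atlas A" and J: "almost_complex_structure A J" and l: "l * l = 1"
  shows "gen_almost_complex_structure A (gen_J A l J)"
proof -
  have JX: "J X \<in> vector_fields A" "J (J X) = - X" if "X \<in> vector_fields A" for X
    using J that by (auto simp: almost_complex_structure_def)
  have square: "fscale (\<lambda>_. l) (dual_map A J (fscale (\<lambda>_. l) (dual_map A J \<xi>))) = - \<xi>"
    if \<xi>: "\<xi> \<in> one_forms A" for \<xi>
  proof (rule ext)
    fix X
    show "fscale (\<lambda>_. l) (dual_map A J (fscale (\<lambda>_. l) (dual_map A J \<xi>))) X = (- \<xi>) X"
    \<comment> \<open>Equality of forms is equality of HOL functions, so arguments that are not
      vector fields count as well; there both sides are 0 by normalisation.\<close>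
    proof (cases "X \<in> vector_fields A")
      case True
      then show ?thesis
        using l by (simp add: fscale_def dual_map_def JX one_form_uminus[OF \<xi>] fun_eq_iff
            mult.assoc[symmetric])
    next
      case False
      then show ?thesis
        by (simp add: fscale_def dual_map_def one_form_outside[OF \<xi>] fun_eq_iff)
    qed
  qed
  show ?thesis
    unfolding gen_almost_complex_structure_def gen_sections_def
  proof (safe, goal_cases)
    case 1
    then show ?case
      by (simp add: gen_J_apply JX one_forms_fscale[OF A smooth_functions_const]
          dual_map_one_form[OF A J])
  next
    case 2
    then show ?case
      using J by (auto simp: gen_J_apply almost_complex_structure_def dual_map_def fscale_def
          fun_eq_iff algebra_simps)
  next
    case 3
    then show ?case
      using J by (auto simp: gen_J_apply gen_scale_def almost_complex_structure_def dual_map_def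
          \<comment> \<open>The type restriction unfolds multiples of forms only, so that multiples
            of vector fields still match the linearity of \<open>J\<close>.\<close>
          fscale_def[of _ "_ :: _ form"] fun_eq_iff algebra_simps)
  next
    case 4
    then show ?case by (simp add: gen_J_apply JX square)
  qed
qed

text \<open>Each summand acquires one factor \<open>l\<close> and two applications of
  \<open>J\<close>, as in l \<xi>(J(J Y)) = -l \<xi>(Y). One computation thus yields the Hermitian
  case at l = -1 and the Norden case at l = 1.\<close>

lemma natural_metric_gen_J:
  assumes J: "almost_complex_structure A J"
    and uv: "u \<in> gen_sections A" "v \<in> gen_sections A"
  shows "natural_metric (gen_J A l J u) (gen_J A l J v) = (\<lambda>_. - l) * natural_metric u v"
proof -
  have JX: "J X \<in> vector_fields A" "J (J X) = - X" if "X \<in> vector_fields A" for X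
    using J that by (auto simp: almost_complex_structure_def)
  obtain X \<xi> Y \<eta> where "u = (X, \<xi>)" "v = (Y, \<eta>)" by (cases u, cases v)
  then show ?thesis
    using uv by (simp add: gen_sections_def gen_J_apply natural_metric_def fscale_def dual_map_def
        JX one_form_uminus[of _ A]) (simp add: fun_eq_iff field_simps)
qed

text \<open>Both sides equal (l \<xi>(J Y) + \<eta>(J X)) / 2; function-linearity of \<xi> moves the
  constant \<open>l\<close> from the form to its argument \<open>J Y\<close>.\<close>

lemma fundamental_tensor_gen_J:
  assumes J: "almost_complex_structure A J"
    and "X \<in> vector_fields A" "Y \<in> vector_fields A" "\<xi> \<in> one_forms A"
  shows "fundamental_tensor (gen_J A l J) natural_metric (X, \<xi>) (Y, \<eta>) =
    natural_metric (J X, \<xi>) (fscale (\<lambda>_. l) (J Y), \<eta>)"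
proof -
  have "J Y \<in> vector_fields A" using assms by (simp add: almost_complex_structure_def)
  then show ?thesis
    using assms(2-4) one_form_fscale[OF assms(4) smooth_functions_const, of "J Y" l]
    by (simp add: fundamental_tensor_def gen_J_apply natural_metric_def)
       (simp add: fscale_def dual_map_def)
qed

theorem proposition4p7:
  fixes A :: "('m::{t2_space,second_countable_topology}, 'e::euclidean_space) chart set"
    and J :: "'m field \<Rightarrow> 'm field"
  assumes "smooth_atlas A"
    and "almost_complex_structure A J"
  shows "gen_indefinite_almost_hermitian A (gen_J A (-1) J) natural_metric \<and>
    gen_almost_norden A (gen_J A 1 J) natural_metric \<and>
    (\<forall>l\<in>{1, -1}. \<forall>X\<in>vector_fields A. \<forall>Y\<in>vector_fields A.
       \<forall>\<xi>\<in>one_forms A. \<forall>\<eta>\<in>one_forms A.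
         fundamental_tensor (gen_J A l J) natural_metric (X, \<xi>) (Y, \<eta>) =
         natural_metric (J X, \<xi>) (fscale (\<lambda>_. l) (J Y), \<eta>))"
proof (intro conjI ballI)
  note metric = natural_metric_non_positive_definite[OF assms(1)]
  show "gen_indefinite_almost_hermitian A (gen_J A (-1) J) natural_metric"
    using gen_J_almost_complex[OF assms, of "-1"] metric
    by (simp add: gen_indefinite_almost_hermitian_def natural_metric_gen_J[OF assms(2)] fun_eq_iff)
  show "gen_almost_norden A (gen_J A 1 J) natural_metric"
    using gen_J_almost_complex[OF assms, of 1] metric
    by (simp add: gen_almost_norden_def natural_metric_gen_J[OF assms(2)] fun_eq_iff)
qed (rule fundamental_tensor_gen_J[OF assms(2)])

end
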